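(* Let $G$ be a locally compact abelian group that is not a torsion group, and let $\mu$ be a Haar measure on $G$. Let $n \geq 2$ and $H \geq 2$ be integers and let $\mathbf{u}_1,\ldots,\mathbf{u}_H \in \mathbf{N}^n$ be arbitrary $n$-tuples of positive integers. Then there exist measurable subsets $A_1,\ldots,A_n$ of $G$ such that \[ \tau\left(\mu(hA_1),\ldots,\mu(hA_n)\right) = \tau(\mathbf{u}_h) \] for all $h = 1,\ldots,H$.
   Context: $\mathbf{N} = \{1,2,3,\ldots\}$. For a subset $A$ of an additive abelian group and a positive integer $h$, the $h$-fold sumset is $hA = \{a_1+\cdots+a_h : a_i \in A \text{ for all } i\}$. The normalization of an $n$-tuple $\mathbf{u} = (u_1,\ldots,u_n)$ (of integers, or more generally of elements of a totally ordered set such as $[0,\infty]$) is the $n$-tuple $\tau(\mathbf{u})$ obtained by replacing each entry equal to the $i$-th smallest distinct value among the entries of $\mathbf{u}$ by $i$, for all $i$ (so equal entries receive equal values; e.g. $\tau(7,3,2,9,3,5) = (4,2,1,5,2,3)$). Thus $\tau(\mathbf{u}) = \tau(\mathbf{v})$ means the two tuples have the same relative order (including ties). *)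

theory Defs
  imports "HOL-Analysis.Analysis"
begin

definition sumset :: "nat \<Rightarrow> 'a::comm_monoid_add set \<Rightarrow> 'a set" where
  "sumset h A = {\<Sum>i<h. a i | a. \<forall>i<h. a i \<in> A}"

text \<open>The \<open>i\<close>-th smallest distinct entry of \<open>u\<close> is the entry \<open>x\<close> such that exactly \<open>i\<close>
  distinct entries of \<open>u\<close> are \<open>\<le> x\<close>. Tuples are lists.\<close>

definition normalization :: "'b::linorder list \<Rightarrow> nat list" where
  "normalization u = map (\<lambda>x. card {y \<in> set u. y \<le> x}) u"

lemma normalization_example: "normalization [7, 3, 2, 9, 3, 5 :: nat] = [4, 2, 1, 5, 2, 3]"
  by code_simp

text \<open>The finite sum below is the multiple \<open>k \<cdot> g\<close>.\<close>

definition torsion_group :: "'a::ab_group_add itself \<Rightarrow> bool" where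
  "torsion_group _ \<longleftrightarrow> (\<forall>g::'a. \<exists>k::nat. k \<ge> 1 \<and> (\<Sum>i<k. g) = 0)"

text \<open>A Haar measure is a nonzero translation-invariant Radon measure on the Borel sets. Groups
  need not be \<open>\<sigma>\<close>-compact, so inner regularity is only required on open sets.\<close>

definition haar_measure :: "'a::{topological_ab_group_add, t2_space} measure \<Rightarrow> bool" where
  "haar_measure M \<longleftrightarrow>
     sets M = sets borel \<and>
     emeasure M UNIV \<noteq> 0 \<and>
     (\<forall>g. \<forall>B \<in> sets borel. emeasure M ((\<lambda>x. g + x) ` B) = emeasure M B) \<and>
     (\<forall>K. compact K \<longrightarrow> emeasure M K < \<infinity>) \<and>
     (\<forall>B \<in> sets borel. emeasure M B = (INF U \<in> {U. open U \<and> B \<subseteq> U}. emeasure M U)) \<and>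
     (\<forall>U. open U \<longrightarrow> emeasure M U = (SUP K \<in> {K. compact K \<and> K \<subseteq> U}. emeasure M K))"

end

theory Submission
  imports Defs "HOL-Library.Set_Algebras"
begin

text \<open>Cardinalities of sumsets multiply under products, and product sets of finite sets of natural
  numbers embed in the natural numbers. So the functions \<open>h \<mapsto> |hC| / |hD|\<close> on \<open>{1..H}\<close>, for finite
  \<open>C, D\<close>, form a group under multiplication. The set \<open>{0..m} \<union> {s..N}\<close> with
  \<open>s = h m + 1 + k\<close>, \<open>k \<le> m\<close> and \<open>N\<close> large has as \<open>h\<close>-fold sumset an interval with exactly \<open>k\<close> integers missing, while its
  \<open>j\<close>-fold sumset is an interval for \<open>j > h\<close>; varying \<open>k\<close> gives ratio functions with value
  \<open>(p + 1) / p\<close> at \<open>h\<close>, for all large \<open>p\<close>, and \<open>1\<close> beyond \<open>h\<close>. By telescoping, every positive rational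
  occurs at \<open>h\<close>, and triangular elimination shows that every positive rational function on
  \<open>{1..H}\<close> is a ratio function. Putting the ratios \<open>u\<^sub>h(i)\<close> over a common denominator gives
  finite \<open>F\<^sub>1, \<dots>, F\<^sub>n\<close> with \<open>|h F\<^sub>i|\<close> proportional to \<open>u\<^sub>h(i)\<close> for every \<open>h \<le> H\<close>. With \<open>g\<close> of
  infinite order and \<open>U\<close> a small open neighbourhood of \<open>0\<close>, the translates of \<open>hU\<close> by the
  multiples of \<open>g\<close> that occur are disjoint, so \<open>A\<^sub>i = F\<^sub>i g + U\<close> has
  \<open>\<mu>(h A\<^sub>i) = |h F\<^sub>i| \<mu>(hU)\<close>.\<close>

subsection \<open>Sumsets\<close>

lemma sumset_0 [simp]: "sumset 0 A = {0}"
  by (simp add: sumset_def)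

lemma sumset_Suc: "sumset (Suc h) A = sumset h A + A"
proof (intro set_eqI iffI)
  fix x assume "x \<in> sumset (Suc h) A"
  then show "x \<in> sumset h A + A"
    unfolding sumset_def set_plus_def by fastforce
next
  fix x assume "x \<in> sumset h A + A"
  then obtain a b where x: "x = (\<Sum>i<h. a i) + b" and a: "\<forall>i<h. a i \<in> A" and b: "b \<in> A"
    unfolding sumset_def set_plus_def by blast
  have "x = (\<Sum>i<Suc h. (a(h := b)) i)"
    by (simp add: x)
  moreover have "\<forall>i<Suc h. (a(h := b)) i \<in> A"
    using a b by (simp add: less_Suc_eq)
  ultimately show "x \<in> sumset (Suc h) A"
    unfolding sumset_def by blast
qed

lemma sumset_1: "sumset (Suc 0) A = A"
  by (simp add: sumset_Suc set_plus_def)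

lemma finite_sumset: "finite A \<Longrightarrow> finite (sumset h A)"
  by (induction h) (auto simp: sumset_Suc intro: finite_set_plus)

lemma sumset_nonempty: "A \<noteq> {} \<Longrightarrow> sumset h A \<noteq> {}"
  by (induction h) (auto simp: sumset_Suc set_plus_def)

lemma card_sumset_pos: "finite A \<Longrightarrow> A \<noteq> {} \<Longrightarrow> card (sumset h A) > 0"
  by (simp add: card_gt_0_iff finite_sumset sumset_nonempty)

text \<open>By commutativity the summands from \<open>A\<close> and from \<open>B\<close> can be
  regrouped. This serves both product sets and thickening by a neighbourhood.\<close>

lemma sumset_plus: "sumset h (A + B) = sumset h A + sumset h B"
  by (induction h) (simp_all add: sumset_Suc ac_simps set_zero flip: set_zero)

lemma sumset_mono: "A \<subseteq> B \<Longrightarrow> sumset h A \<subseteq> sumset h B"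
  by (induction h) (simp_all add: sumset_Suc set_plus_mono2)

lemma sumset_image:
  assumes "f 0 = 0" and "\<And>x y. f (x + y) = f x + f y"
  shows "sumset h (f ` A) = f ` sumset h A"
proof (induction h)
  case (Suc h)
  then show ?case
    by (fastforce simp: sumset_Suc set_plus_def image_def assms(2))
qed (simp add: assms)

lemma sumset_nat_le:
  fixes A :: "nat set"
  assumes "A \<subseteq> {..N}"
  shows "sumset h A \<subseteq> {..h * N}"
proof (induction h)
  case (Suc h)
  then show ?case
    using assms by (fastforce simp: sumset_Suc set_plus_def)
qed simp

text \<open>For \<open>L\<close> large, \<open>(x, y) \<mapsto> x + L * y\<close> embeds the product set \<open>A \<times> B\<close> in the natural numbers
  without creating new coincidences among sums of up to \<open>H\<close> terms.\<close>

lemma card_sumset_product: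
  fixes A B :: "nat set"
  assumes "finite A" "A \<noteq> {}" "finite B" "B \<noteq> {}"
  obtains E :: "nat set" where "finite E" "E \<noteq> {}"
    "\<And>h. h \<le> H \<Longrightarrow> card (sumset h E) = card (sumset h A) * card (sumset h B)"
proof
  \<comment> \<open>Sums of at most \<open>H\<close> elements of \<open>A\<close> stay below
    \<open>L\<close>, so residue and quotient modulo \<open>L\<close> recover the two
    components.\<close>
  define L where "L = Suc (H * Max A)"
  define E where "E = A + (*) L ` B"
  show "finite E" "E \<noteq> {}"
    using assms by (auto simp: E_def set_plus_def intro: finite_set_plus)
  fix h assume h: "h \<le> H"
  have lt: "x < L" if "x \<in> sumset h A" for x
  proof -
    have "A \<subseteq> {..Max A}" using assms by auto
    then have "x \<le> h * Max A" using sumset_nat_le that by blast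
    also have "\<dots> \<le> H * Max A" using h by simp
    finally show ?thesis by (simp add: L_def)
  qed
  have "sumset h E = sumset h A + (*) L ` sumset h B"
    unfolding E_def sumset_plus by (subst sumset_image) (auto simp: algebra_simps)
  also have "\<dots> = (\<lambda>(x, y). x + L * y) ` (sumset h A \<times> sumset h B)"
    by (auto simp: set_plus_def)
  finally have "sumset h E = (\<lambda>(x, y). x + L * y) ` (sumset h A \<times> sumset h B)" .
  moreover have "inj_on (\<lambda>(x, y). x + L * y) (sumset h A \<times> sumset h B)"
  proof (rule inj_onI, clarify)
    fix x y x' y'
    assume "x \<in> sumset h A" "x' \<in> sumset h A" and eq: "x + L * y = x' + L * y'"
    then have "x < L" "x' < L" using lt by auto
    then have "x = x'" using arg_cong[OF eq, of "\<lambda>z. z mod L"] by simp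
    moreover have "L > 0" by (simp add: L_def)
    ultimately show "x = x' \<and> y = y'" using eq by simp
  qed
  ultimately show "card (sumset h E) = card (sumset h A) * card (sumset h B)"
    by (simp add: card_image card_cartesian_product)
qed

section \<open>Sumsets of an interval with a gap\<close>

lemma atLeastAtMost_plus:
  fixes a b c d :: nat
  assumes "a \<le> b" "c \<le> d"
  shows "{a..b} + {c..d} = {a + c..b + d}"
proof (intro set_eqI iffI)
  fix x assume "x \<in> {a + c..b + d}"
  \<comment> \<open>The first summand takes as much as fits after \<open>c\<close> is reserved for
    the second.\<close>
  then have "x = min b (x - c) + (x - min b (x - c))" "min b (x - c) \<in> {a..b}"
      "x - min b (x - c) \<in> {c..d}"
    using assms by auto
  then show "x \<in> {a..b} + {c..d}"
    by (metis set_plus_intro)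
qed (auto simp: set_plus_def)

text \<open>Sums with i terms from \<open>{s..N}\<close> fill an interval starting at i s. As
  \<open>2 * s \<le> N\<close>, these intervals overlap for consecutive i \<ge> 1, so only the gap
  below \<open>s\<close> can survive.\<close>

lemma sumset_gap:
  fixes m s N :: nat
  assumes "2 * s \<le> N" "m \<le> N"
  shows "sumset (Suc j) ({0..m} \<union> {s..N}) = {0..Suc j * m} \<union> {s..Suc j * N}"
proof (induction j)
  case 0
  then show ?case by (simp add: sumset_1)
next
  case (Suc j)
  have "s \<le> N" using assms by simp
  then have "s \<le> Suc j * N" by (simp add: trans_le_add1)
  have "sumset (Suc (Suc j)) ({0..m} \<union> {s..N})
      = ({0..Suc j * m} \<union> {s..Suc j * N}) + ({0..m} \<union> {s..N})"
    by (simp only: sumset_Suc[of "Suc j"] Suc.IH)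
  also have "\<dots> = ({0..Suc j * m} + {0..m}) \<union> ({0..Suc j * m} + {s..N})
      \<union> (({s..Suc j * N} + {0..m}) \<union> ({s..Suc j * N} + {s..N}))"
    by (auto simp: set_plus_def)
  also have "\<dots> = {0..Suc (Suc j) * m} \<union> {s..Suc j * m + N}
      \<union> ({s..Suc j * N + m} \<union> {s + s..Suc j * N + N})"
    using \<open>s \<le> N\<close> \<open>s \<le> Suc j * N\<close> by (simp add: atLeastAtMost_plus add.commute del: mult_Suc)
       (simp add: algebra_simps)
  also have "\<dots> = {0..Suc (Suc j) * m} \<union> {s..Suc (Suc j) * N}"
  proof -
    have "Suc j * m \<le> Suc j * N" using assms by (intro mult_le_mono) auto
    then have "{s..Suc (Suc j) * N} = {s..Suc j * m + N} \<union> {s + s..Suc j * N + N}"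
      using assms by auto
    moreover have "{s..Suc j * N + m} \<subseteq> {s..Suc (Suc j) * N}"
      using assms by auto
    ultimately show ?thesis by auto
  qed
  finally show ?case .
qed

text \<open>The \<open>h\<close>-fold sumset misses the \<open>k\<close> integers strictly between
  \<open>h * m\<close> and \<open>h * m + 1 + k\<close>. For \<open>j > h\<close> the lower interval
  reaches \<open>j * m \<ge> h * m + k\<close>, and the gap closes.\<close>

lemma card_sumset_gap:
  fixes m k h N :: nat
  assumes "k \<le> m" "2 * (h * m + 1 + k) \<le> N" "h \<ge> 1"
  defines "D \<equiv> {0..m} \<union> {h * m + 1 + k..N}"
  shows "card (sumset h D) = h * N + 1 - k"
    and "h < j \<Longrightarrow> card (sumset j D) = j * N + 1"
proof -
  have "1 * m \<le> h * m" using assms(3) by (rule mult_le_mono1)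
  with assms(2) have "m \<le> N" unfolding add_mult_distrib2 nat_mult_1 by linarith
  have sumset: "sumset j D = {0..j * m} \<union> {h * m + 1 + k..j * N}" if "j \<ge> 1" for j
    using sumset_gap[OF assms(2) \<open>m \<le> N\<close>, of "j - 1"] that by (simp add: D_def)
  have "h * m + 1 + k \<le> N" using assms by simp
  also have "N \<le> h * N" using assms by simp
  finally have le: "h * m + 1 + k \<le> h * N" .
  have "card (sumset h D) = card {0..h * m} + card {h * m + 1 + k..h * N}"
    unfolding sumset[OF assms(3)] by (intro card_Un_disjoint) auto
  also have "\<dots> = h * N + 1 - k" using le by simp
  finally show "card (sumset h D) = h * N + 1 - k" .
  assume "h < j"
  have "Suc h * m \<le> j * m" using \<open>h < j\<close> by (intro mult_le_mono) auto
  then have 1: "h * m + 1 + k \<le> j * m + 1" using assms by (simp only: mult_Suc)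
  have 2: "j * m \<le> j * N" using \<open>m \<le> N\<close> by simp
  have "sumset j D = {0..j * N}"
    unfolding sumset[OF order_trans[OF assms(3) less_imp_le[OF \<open>h < j\<close>]]]
    using 1 2 by (auto intro: order_trans[OF _ 2] simp del: mult_le_cancel1)
  then show "card (sumset j D) = j * N + 1" by simp
qed

subsection \<open>Ratios of sumset sizes\<close>

definition sumset_ratio :: "nat \<Rightarrow> (nat \<Rightarrow> rat) \<Rightarrow> bool" where
  "sumset_ratio H r \<longleftrightarrow> (\<exists>(A :: nat set) (B :: nat set). finite A \<and> A \<noteq> {} \<and> finite B \<and> B \<noteq> {} \<and>
     (\<forall>h \<in> {1..H}. of_nat (card (sumset h A)) = r h * of_nat (card (sumset h B))))"

lemma sumset_ratioI:
  fixes A B :: "nat set"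
  assumes "finite A" "A \<noteq> {}" "finite B" "B \<noteq> {}"
    and "\<And>h. h \<in> {1..H} \<Longrightarrow> of_nat (card (sumset h A)) = r h * of_nat (card (sumset h B))"
  shows "sumset_ratio H r"
  using assms unfolding sumset_ratio_def by blast

lemma sumset_ratio_cong:
  "sumset_ratio H r \<Longrightarrow> (\<And>h. h \<in> {1..H} \<Longrightarrow> r h = r' h) \<Longrightarrow> sumset_ratio H r'"
  unfolding sumset_ratio_def by metis

lemma sumset_ratio_one: "sumset_ratio H (\<lambda>_. 1)"
  by (rule sumset_ratioI[of "{0}" "{0}"]) auto

text \<open>Product sets multiply numerators and denominators separately.\<close>

lemma sumset_ratio_mult:
  assumes "sumset_ratio H r" "sumset_ratio H r'"
  shows "sumset_ratio H (\<lambda>h. r h * r' h)"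
proof -
  obtain A B :: "nat set" where AB: "finite A" "A \<noteq> {}" "finite B" "B \<noteq> {}"
    "\<And>h. h \<in> {1..H} \<Longrightarrow> of_nat (card (sumset h A)) = r h * of_nat (card (sumset h B))"
    using assms(1) unfolding sumset_ratio_def by blast
  obtain A' B' :: "nat set" where AB': "finite A'" "A' \<noteq> {}" "finite B'" "B' \<noteq> {}"
    "\<And>h. h \<in> {1..H} \<Longrightarrow> of_nat (card (sumset h A')) = r' h * of_nat (card (sumset h B'))"
    using assms(2) unfolding sumset_ratio_def by blast
  obtain E :: "nat set" where E: "finite E" "E \<noteq> {}"
    "\<And>h. h \<le> H \<Longrightarrow> card (sumset h E) = card (sumset h A) * card (sumset h A')"
    using card_sumset_product[OF AB(1,2) AB'(1,2), of H] by metis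
  obtain E' :: "nat set" where E': "finite E'" "E' \<noteq> {}"
    "\<And>h. h \<le> H \<Longrightarrow> card (sumset h E') = card (sumset h B) * card (sumset h B')"
    using card_sumset_product[OF AB(3,4) AB'(3,4), of H] by metis
  show ?thesis
  proof (rule sumset_ratioI[OF E(1,2) E'(1,2)])
    fix h assume h: "h \<in> {1..H}"
    show "of_nat (card (sumset h E)) = r h * r' h * of_nat (card (sumset h E'))"
      using h by (simp add: E(3) E'(3) AB(5)[OF h] AB'(5)[OF h])
  qed
qed

lemma sumset_ratio_inverse:
  assumes "sumset_ratio H r"
  shows "sumset_ratio H (\<lambda>h. inverse (r h))"
proof -
  obtain A B :: "nat set" where AB: "finite A" "A \<noteq> {}" "finite B" "B \<noteq> {}"
    "\<And>h. h \<in> {1..H} \<Longrightarrow> of_nat (card (sumset h A)) = r h * of_nat (card (sumset h B))"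
    using assms unfolding sumset_ratio_def by blast
  show ?thesis
  proof (rule sumset_ratioI[OF AB(3,4) AB(1,2)])
    fix h assume "h \<in> {1..H}"
    note eq = AB(5)[OF this]
    moreover have "r h \<noteq> 0"
      using eq card_sumset_pos[OF AB(1,2), of h] by auto
    ultimately show "of_nat (card (sumset h B)) = inverse (r h) * of_nat (card (sumset h A))"
      by simp
  qed
qed

text \<open>These are the pivots of the triangular elimination: multiplying by such an
  \<open>r\<close> keeps all values beyond \<open>h\<close>, and may change those below
  \<open>h\<close> by positive factors.\<close>

definition top_ratio :: "nat \<Rightarrow> nat \<Rightarrow> rat \<Rightarrow> bool" where
  "top_ratio H h q \<longleftrightarrow> (\<exists>r. sumset_ratio H r \<and> (\<forall>j. r j > 0) \<and> r h = q \<and> (\<forall>j>h. r j = 1))"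

lemma top_ratio_mult:
  assumes "top_ratio H h p" "top_ratio H h q"
  shows "top_ratio H h (p * q)"
proof -
  obtain r where "sumset_ratio H r" "\<forall>j. r j > 0" "r h = p" "\<forall>j>h. r j = 1"
    using assms(1) unfolding top_ratio_def by blast
  moreover obtain r' where "sumset_ratio H r'" "\<forall>j. r' j > 0" "r' h = q" "\<forall>j>h. r' j = 1"
    using assms(2) unfolding top_ratio_def by blast
  ultimately show ?thesis
    unfolding top_ratio_def by (intro exI[of _ "\<lambda>h. r h * r' h"]) (simp add: sumset_ratio_mult)
qed

lemma top_ratio_inverse:
  assumes "top_ratio H h p"
  shows "top_ratio H h (inverse p)"
proof -
  obtain r where "sumset_ratio H r" "\<forall>j. r j > 0" "r h = p" "\<forall>j>h. r j = 1"
    using assms unfolding top_ratio_def by blast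
  then show ?thesis
    unfolding top_ratio_def by (intro exI[of _ "\<lambda>h. inverse (r h)"]) (simp add: sumset_ratio_inverse)
qed

text \<open>Write p = h N - k with 0 \<le> k < h. The gap sets with m = h and parameters
  \<open>k\<close>, \<open>Suc k\<close> have \<open>h\<close>-fold sumsets of sizes p + 1 and p,
  and equally large \<open>j\<close>-fold sumsets for j > h.\<close>

lemma top_ratio_Suc:
  assumes "h \<ge> 1" and p: "p \<ge> 2 * h * (h * h + 1 + h)"
  shows "top_ratio H h (of_nat (Suc p) / of_nat p)"
proof -
  \<comment> \<open>\<open>N\<close> is p / h rounded up, so k < h and both \<open>k\<close> and
    \<open>Suc k\<close> are admissible gap parameters.\<close>
  define N where "N = (p + h - 1) div h"
  define k where "k = h * N - p"
  have *: "h * N + (p + h - 1) mod h = p + h - 1"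
    by (simp add: N_def)
  moreover have "(p + h - 1) mod h < h" using assms by simp
  ultimately have "p \<le> h * N" "k < h"
    using assms unfolding k_def by linarith+
  then have hN: "h * N = p + k" by (simp add: k_def)
  \<comment> \<open>The bound on \<open>p\<close> is \<open>h\<close> times a lower bound for
    \<open>N\<close> that suffices for both parameters.\<close>
  have "h * (2 * (h * h + 1 + h)) \<le> h * N"
    using p \<open>p \<le> h * N\<close> by (simp add: algebra_simps)
  then have N: "2 * (h * h + 1 + h) \<le> N" using assms(1) by (metis mult_le_cancel1 less_le_trans zero_less_one)
  define D where "D = (\<lambda>k. {0..h} \<union> {h * h + 1 + k..N})"
  have D: "finite (D k)" "D k \<noteq> {}" for k
    by (auto simp: D_def)
  define r :: "nat \<Rightarrow> rat"
    where "r j = of_nat (card (sumset j (D k))) / of_nat (card (sumset j (D (Suc k))))" for j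
  have k: "k \<le> h" "2 * (h * h + 1 + k) \<le> N" and Sk: "Suc k \<le> h" "2 * (h * h + 1 + Suc k) \<le> N"
    using N \<open>k < h\<close> by auto
  have "r j = 1" if "h < j" for j
    using card_sumset_gap(2)[OF k assms(1) that] card_sumset_gap(2)[OF Sk assms(1) that]
    unfolding r_def D_def by (simp del: of_nat_Suc of_nat_add)
  moreover have "r h = of_nat (Suc p) / of_nat p"
    using card_sumset_gap(1)[OF k assms(1)] card_sumset_gap(1)[OF Sk assms(1)]
    unfolding r_def D_def hN by simp
  moreover have pos: "of_nat (card (sumset j (D k))) > (0 :: rat)" for j k
    using card_sumset_pos[OF D] by simp
  then have "r j > 0" for j by (simp add: r_def)
  moreover have "sumset_ratio H r"
    by (rule sumset_ratioI[of "D k" "D (Suc k)"]) (use D pos[of _ "Suc k"] in \<open>auto simp: r_def less_imp_neq[THEN not_sym]\<close>)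
  ultimately show ?thesis unfolding top_ratio_def by blast
qed

text \<open>The factors (p + 1) / p for p from \<open>P\<close> to a - 1 telescope to a / P.
  Quotients of such values give all positive rationals.\<close>

lemma top_ratio:
  assumes "h \<ge> 1" "q > 0"
  shows "top_ratio H h q"
proof -
  define P where "P = 2 * h * (h * h + 1 + h)"
  have P: "P > 0" using assms by (simp add: P_def)
  have *: "top_ratio H h (of_nat a / of_nat P)" if "a \<ge> P" for a
    using that
  proof (induction a rule: nat_induct_at_least)
    case base
    have "top_ratio H h 1"
      unfolding top_ratio_def by (rule exI[of _ "\<lambda>_. 1"]) (simp add: sumset_ratio_one)
    then show ?case using P by simp
  next
    case (Suc a)
    have "top_ratio H h (of_nat (Suc a) / of_nat a)"
      using top_ratio_Suc assms(1) Suc.hyps unfolding P_def by blast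
    from top_ratio_mult[OF this Suc.IH] show ?case
      using Suc.hyps P by (simp del: of_nat_Suc)
  qed
  \<comment> \<open>A positive integer a is (a P) / P, with numerator at least
    \<open>P\<close>.\<close>
  have nat: "top_ratio H h (of_nat a)" if "a > 0" for a
    using *[of "a * P"] that P by simp
  obtain a b where "quotient_of q = (a, b)" by fastforce
  then have q: "q = of_int a / of_int b" "b > 0"
    using quotient_of_div quotient_of_denom_pos by blast+
  then have "a > 0" using assms(2) by (simp add: zero_less_divide_iff)
  with q have "q = of_nat (nat a) * inverse (of_nat (nat b))" "nat a > 0" "nat b > 0"
    by (simp_all add: divide_inverse)
  then show ?thesis
    using nat top_ratio_mult top_ratio_inverse by metis
qed

text \<open>Elimination runs downward: dividing by a pivot \<open>f\<close> makes the value at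
  \<open>Suc k\<close> equal to 1 and keeps those beyond. It disturbs only smaller indices, where
  the induction hypothesis allows any positive values.\<close>

lemma sumset_ratio:
  assumes "\<And>h. r h > 0"
  shows "sumset_ratio H r"
proof -
  have "sumset_ratio H r" if "\<And>h. r h > 0" "\<And>j. k < j \<Longrightarrow> r j = 1" for k r
    using that
  proof (induction k arbitrary: r)
    case 0
    then show ?case by (intro sumset_ratio_cong[OF sumset_ratio_one]) auto
  next
    case (Suc k)
    obtain f where f: "sumset_ratio H f" "\<forall>j. f j > 0" "f (Suc k) = r (Suc k)"
        "\<forall>j>Suc k. f j = 1"
      using top_ratio[of "Suc k" "r (Suc k)" H] Suc.prems(1) unfolding top_ratio_def by auto
    have "sumset_ratio H (\<lambda>j. r j / f j)"
    proof (rule Suc.IH)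
      show "r j / f j > 0" for j using Suc.prems(1) f(2) by simp
      show "r j / f j = 1" if "k < j" for j
        using f Suc.prems that by (cases "j = Suc k") (auto simp: less_imp_neq[THEN not_sym])
    qed
    from sumset_ratio_mult[OF this f(1)] show ?case
      by (rule sumset_ratio_cong) (use f(2) in \<open>simp add: less_imp_neq[THEN not_sym]\<close>)
  qed
  \<comment> \<open>Replacing \<open>r\<close> by 1 beyond \<open>H\<close> gives the elimination a
    starting index without affecting \<open>{1..H}\<close>.\<close>
  from this[of "\<lambda>j. if j \<le> H then r j else 1" H]
  have "sumset_ratio H (\<lambda>j. if j \<le> H then r j else 1)" using assms by simp
  then show ?thesis by (rule sumset_ratio_cong) auto
qed

text \<open>Common denominators: if \<open>v n\<close> is realised as \<open>C\<close> over
  \<open>D\<close>, the denominator \<open>X\<close> becomes X \<times> D, each earlier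
  \<open>F i\<close> becomes F i \<times> D, and the new numerator is X \<times> C.\<close>

lemma proportional_sumset_cards:
  fixes v :: "nat \<Rightarrow> nat \<Rightarrow> nat"
  assumes "\<And>i h. v i h > 0"
  shows "\<exists>(F :: nat \<Rightarrow> nat set) X :: nat set. finite X \<and> X \<noteq> {} \<and> (\<forall>i<n. finite (F i) \<and> F i \<noteq> {}) \<and>
    (\<forall>i<n. \<forall>h\<in>{1..H}. card (sumset h (F i)) = v i h * card (sumset h X))"
proof (induction n)
  case 0
  then show ?case by (intro exI[of _ "\<lambda>_. {}"] exI[of _ "{0}"]) simp
next
  case (Suc n)
  then obtain F :: "nat \<Rightarrow> nat set" and X :: "nat set" where X: "finite X" "X \<noteq> {}"
    and F: "\<And>i. i < n \<Longrightarrow> finite (F i)" "\<And>i. i < n \<Longrightarrow> F i \<noteq> {}"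
      "\<And>i h. i < n \<Longrightarrow> h \<in> {1..H} \<Longrightarrow> card (sumset h (F i)) = v i h * card (sumset h X)"
    by blast
  have "sumset_ratio H (\<lambda>h. of_nat (v n h))"
    using assms by (intro sumset_ratio) simp
  then obtain C D :: "nat set" where C: "finite C" "C \<noteq> {}" and D: "finite D" "D \<noteq> {}"
    and "\<forall>h\<in>{1..H}. (of_nat (card (sumset h C)) :: rat) = of_nat (v n h) * of_nat (card (sumset h D))"
    unfolding sumset_ratio_def by metis
  then have CD: "card (sumset h C) = v n h * card (sumset h D)" if "h \<in> {1..H}" for h
    using that unfolding of_nat_mult[symmetric] of_nat_eq_iff by metis
  \<comment> \<open>For up to \<open>H\<close>-fold sums, \<open>E\<close> counts like the product
    set A \<times> B.\<close>
  define pr where "pr A B E \<longleftrightarrow> finite E \<and> E \<noteq> {} \<and>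
    (\<forall>h\<le>H. card (sumset h E) = card (sumset h A) * card (sumset h B))" for A B E :: "nat set"
  have pr: "\<exists>E. pr A B E" if "finite A" "A \<noteq> {}" "finite B" "B \<noteq> {}" for A B
    unfolding pr_def by (rule card_sumset_product[OF that, of H]) blast
  obtain Y where Y: "pr X D Y" using pr X D by blast
  have "\<forall>i<Suc n. \<exists>E. pr (if i < n then F i else X) (if i < n then D else C) E"
    using pr X D C F by simp
  then obtain F' where F': "\<And>i. i < Suc n \<Longrightarrow> pr (if i < n then F i else X) (if i < n then D else C) (F' i)"
    by metis
  have "card (sumset h (F' i)) = v i h * card (sumset h Y)" if "i < Suc n" "h \<in> {1..H}" for i h
  proof (cases "i < n")
    case True
    then show ?thesis using F'[OF that(1)] that(2) F(3)[OF True that(2)] Y by (simp add: pr_def)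
  next
    case False
    then show ?thesis using F'[OF that(1)] that CD[OF that(2)] Y by (simp add: pr_def less_Suc_eq)
  qed
  moreover have "finite (F' i) \<and> F' i \<noteq> {}" if "i < Suc n" for i
    using F'[OF that] by (simp add: pr_def)
  moreover have "finite Y \<and> Y \<noteq> {}" using Y by (simp add: pr_def)
  ultimately show ?case by (intro exI[of _ F'] exI[of _ Y]) blast
qed

subsection \<open>Transfer to topological groups\<close>

text \<open>Ranks count distinct entries, and \<open>f\<close> preserves distinctness and order.
  Later \<open>f\<close> is scaling by a positive finite measure.\<close>

lemma normalization_map:
  fixes f :: "'b::linorder \<Rightarrow> 'c::linorder"
  assumes "strict_mono f"
  shows "normalization (map f xs) = normalization xs"
proof -
  have "{y \<in> f ` set xs. y \<le> f x} = f ` {y \<in> set xs. y \<le> x}" for x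
    using strict_mono_less_eq[OF assms] by auto
  moreover have "inj_on f S" for S
    using strict_mono_eq[OF assms] by (auto intro: inj_onI)
  ultimately show ?thesis
    by (simp add: normalization_def card_image)
qed

definition nat_multiple :: "'a::comm_monoid_add \<Rightarrow> nat \<Rightarrow> 'a" where
  "nat_multiple g k = (\<Sum>i<k. g)"

lemma nat_multiple_0 [simp]: "nat_multiple g 0 = 0"
  by (simp add: nat_multiple_def)

lemma nat_multiple_add: "nat_multiple g (j + k) = nat_multiple g j + nat_multiple g k"
  by (induction k) (simp_all add: nat_multiple_def ac_simps)

section \<open>Open sumsets and neighbourhoods of zero\<close>

lemma open_plus_singleton:
  fixes U :: "'a::topological_ab_group_add set"
  assumes "open U"
  shows "open ((+) g ` U)"
proof -
  have "(+) g ` U = (\<lambda>x. x + (- g)) -` U"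
  proof (intro set_eqI iffI)
    fix x assume "x \<in> (\<lambda>x. x + (- g)) -` U"
    then show "x \<in> (+) g ` U" by (intro image_eqI[of _ _ "x + (- g)"]) simp_all
  qed auto
  then show ?thesis
    using assms by (auto intro!: open_vimage continuous_intros)
qed

lemma open_set_plus:
  fixes A U :: "'a::topological_ab_group_add set"
  assumes "open U"
  shows "open (A + U)"
proof -
  have "A + U = (\<Union>a\<in>A. (+) a ` U)"
    by (auto simp: set_plus_def)
  then show ?thesis using open_plus_singleton[OF assms] by auto
qed

lemma open_sumset:
  fixes U :: "'a::topological_ab_group_add set"
  assumes "open U" "h \<ge> 1"
  shows "open (sumset h U)"
  using assms by (cases h) (simp_all add: sumset_Suc open_set_plus)

text \<open>Subtraction is continuous at (0, 0), and a neighbourhood of this pair contains a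
  square.\<close>

lemma nhd_zero_diff:
  fixes W :: "'a::topological_ab_group_add set"
  assumes "open W" "0 \<in> W"
  obtains V where "open V" "0 \<in> V" "\<And>x y. x \<in> V \<Longrightarrow> y \<in> V \<Longrightarrow> x - y \<in> W"
proof -
  have "((\<lambda>p. fst p + - snd p) \<longlongrightarrow> (0 + - 0 :: 'a)) (nhds 0 \<times>\<^sub>F nhds 0)"
    by (intro tendsto_add tendsto_minus filterlim_fst filterlim_snd)
  then have "eventually (\<lambda>p. fst p + - snd p \<in> W) (nhds (0 :: 'a) \<times>\<^sub>F nhds 0)"
    using assms by (auto simp: tendsto_def)
  then obtain P where "eventually P (nhds (0 :: 'a))"
      and P: "\<forall>x y. P x \<longrightarrow> P y \<longrightarrow> fst (x, y) + - snd (x, y) \<in> W"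
    unfolding eventually_prod_same by blast
  then obtain V where "open V" "0 \<in> V" and V: "\<forall>x\<in>V. P x"
    unfolding eventually_nhds by blast
  show ?thesis
  proof (rule that[OF \<open>open V\<close> \<open>0 \<in> V\<close>])
    show "x - y \<in> W" if "x \<in> V" "y \<in> V" for x y
      using P V that by simp
  qed
qed

lemma nhd_zero_sumset:
  fixes W :: "'a::topological_ab_group_add set"
  assumes "open W" "0 \<in> W"
  shows "\<exists>U. open U \<and> 0 \<in> U \<and> (\<forall>h\<le>H. sumset h U \<subseteq> W)"
  using assms
proof (induction H arbitrary: W)
  case 0
  then show ?case by auto
next
  case (Suc H)
  obtain V where V: "open V" "0 \<in> V" "\<And>x y. x \<in> V \<Longrightarrow> y \<in> V \<Longrightarrow> x - y \<in> W"
    using nhd_zero_diff[OF Suc.prems] by metis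
  \<comment> \<open>Since 0 - y \<in> V for y \<in> V', differences can be turned into sums.\<close>
  obtain V' where V': "open V'" "0 \<in> V'" "\<And>x y. x \<in> V' \<Longrightarrow> y \<in> V' \<Longrightarrow> x - y \<in> V"
    using nhd_zero_diff[OF V(1,2)] by metis
  have add: "x + y \<in> W" if "x \<in> V \<inter> V'" "y \<in> V \<inter> V'" for x y
  proof -
    have "0 - y \<in> V" using that V'(2,3) by blast
    then have "x - (0 - y) \<in> W" using that V(3) by blast
    then show ?thesis by simp
  qed
  have "open (V \<inter> V')" "0 \<in> V \<inter> V'" using V V' by auto
  from Suc.IH[OF this] obtain U where U: "open U" "0 \<in> U" "\<forall>h\<le>H. sumset h U \<subseteq> V \<inter> V'"
    by blast
  \<comment> \<open>The intersection puts single elements into V \<inter> V' even when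
    \<open>H = 0\<close>, where the induction hypothesis only concerns the empty sum.\<close>
  define U' where "U' = U \<inter> (V \<inter> V')"
  have sub: "sumset h U' \<subseteq> V \<inter> V'" if "h \<le> H" for h
    using U(3) that sumset_mono[of U' U h] by (auto simp: U'_def)
  have "sumset h U' \<subseteq> W" if "h \<le> Suc H" for h
  proof (cases h)
    case 0
    then show ?thesis using Suc.prems by simp
  next
    case (Suc k)
    have "sumset k U' \<subseteq> V \<inter> V'" "U' \<subseteq> V \<inter> V'"
      using sub[of k] Suc that by (auto simp: U'_def)
    then show ?thesis
      using add unfolding Suc sumset_Suc set_plus_def by blast
  qed
  moreover have "open U'" "0 \<in> U'" using U V V' by (auto simp: U'_def)
  ultimately show ?case by blast
qed

section \<open>Haar measure of open sets and their translates\<close>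

lemma haar_measureD:
  assumes "haar_measure M"
  shows "sets M = sets borel"
    and "emeasure M UNIV \<noteq> 0"
    and "B \<in> sets borel \<Longrightarrow> emeasure M ((+) g ` B) = emeasure M B"
    and "compact K \<Longrightarrow> emeasure M K < \<infinity>"
    and "open U \<Longrightarrow> emeasure M U = (SUP K \<in> {K. compact K \<and> K \<subseteq> U}. emeasure M K)"
proof -
  note haar = assms[unfolded haar_measure_def]
  show "sets M = sets borel"
    by (rule haar[THEN conjunct1])
  show "emeasure M UNIV \<noteq> 0"
    by (rule haar[THEN conjunct2, THEN conjunct1])
  show "emeasure M ((+) g ` B) = emeasure M B" if "B \<in> sets borel"
    by (rule haar[THEN conjunct2, THEN conjunct2, THEN conjunct1, rule_format, OF that])
  show "emeasure M K < \<infinity>" if "compact K"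
    by (rule haar[THEN conjunct2, THEN conjunct2, THEN conjunct2, THEN conjunct1, rule_format, OF that])
  show "emeasure M U = (SUP K \<in> {K. compact K \<and> K \<subseteq> U}. emeasure M K)" if "open U"
    by (rule haar[THEN conjunct2, THEN conjunct2, THEN conjunct2, THEN conjunct2, THEN conjunct2,
          rule_format, OF that])
qed

text \<open>Inner regularity on the whole space gives a compact set of positive measure. Finitely
  many translates of \<open>V\<close> cover it, and they would be null if \<open>V\<close>
  were.\<close>

lemma haar_measure_open_pos:
  fixes M :: "'a::{topological_ab_group_add, t2_space} measure"
  assumes haar: "haar_measure M" and V: "open V" "V \<noteq> {}"
  shows "emeasure M V > 0"
proof (rule ccontr)
  assume "\<not> emeasure M V > 0"
  then have V0: "emeasure M V = 0" by simp
  note haar = haar_measureD[OF haar]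
  have "(SUP K \<in> {K. compact K \<and> K \<subseteq> UNIV}. emeasure M K) > 0"
    using haar(2) haar(5)[OF open_UNIV] zero_less_iff_neq_zero by metis
  then obtain K where K: "compact K" "emeasure M K > 0"
    unfolding less_SUP_iff by blast
  have borelV: "(+) g ` V \<in> sets M" for g
    using open_plus_singleton[OF V(1)] by (simp add: haar(1))
  obtain v where "v \<in> V" using V by blast
  then have "x \<in> (+) (x - v) ` V" for x
    by (intro image_eqI[of _ _ v]) simp_all
  then have "K \<subseteq> (\<Union>g\<in>UNIV. (+) g ` V)"
    by blast
  then obtain C where C: "finite C" "K \<subseteq> (\<Union>g\<in>C. (+) g ` V)"
    by (rule compactE_image[OF K(1) open_plus_singleton[OF V(1)]])
  have "emeasure M K \<le> emeasure M (\<Union>g\<in>C. (+) g ` V)"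
    using C borelV by (intro emeasure_mono sets.finite_UN) auto
  also have "\<dots> \<le> (\<Sum>g\<in>C. emeasure M ((+) g ` V))"
    using C borelV by (intro emeasure_subadditive_finite) auto
  also have "\<dots> = 0"
    using haar(3) V V0 by simp
  finally show False using K by simp
qed

lemma haar_measure_separated_plus:
  fixes M :: "'a::{topological_ab_group_add, t2_space} measure"
  assumes haar: "haar_measure M" and V: "open V" and "finite F"
    and disj: "\<And>x y. x \<in> F \<Longrightarrow> y \<in> F \<Longrightarrow> x \<noteq> y \<Longrightarrow> (+) x ` V \<inter> (+) y ` V = {}"
  shows "emeasure M (F + V) = of_nat (card F) * emeasure M V"
proof -
  note haar = haar_measureD[OF haar]
  have "F + V = (\<Union>x\<in>F. (+) x ` V)"
    by (auto simp: set_plus_def)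
  then have "emeasure M (F + V) = (\<Sum>x\<in>F. emeasure M ((+) x ` V))"
    using sum_emeasure[of "\<lambda>x. (+) x ` V" F M] open_plus_singleton[OF V] disj \<open>finite F\<close>
    by (simp add: haar(1) disjoint_family_on_def image_subset_iff)
  also have "\<dots> = of_nat (card F) * emeasure M V"
    using haar(3) V by simp
  finally show ?thesis .
qed

theorem theorem3:
  fixes M :: "'a::{topological_ab_group_add, t2_space} measure"
    and n H :: nat
    and u :: "nat \<Rightarrow> nat list"
  assumes "locally_compact_space (euclidean :: 'a topology)"
    and "\<not> torsion_group TYPE('a)"
    and "haar_measure M"
    and "n \<ge> 2" and "H \<ge> 2"
    and "\<And>h. h \<in> {1..H} \<Longrightarrow> length (u h) = n \<and> (\<forall>x \<in> set (u h). x \<ge> 1)"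
  shows "\<exists>A :: 'a set list. length A = n \<and> (\<forall>i<n. A ! i \<in> sets M) \<and>
    (\<forall>h \<in> {1..H}. (\<forall>i<n. sumset h (A ! i) \<in> sets M) \<and>
       normalization (map (\<lambda>B. emeasure M (sumset h B)) A) = normalization (u h))"
proof -
  note haar = haar_measureD[OF assms(3)]
  have "\<exists>g :: 'a. \<forall>k\<ge>1. nat_multiple g k \<noteq> 0"
    using assms(2) unfolding torsion_group_def nat_multiple_def by blast
  then obtain g :: 'a where g: "\<And>k. k \<ge> 1 \<Longrightarrow> nat_multiple g k \<noteq> 0"
    by blast
  \<comment> \<open>\<open>max 1\<close> makes \<open>v\<close> positive at all indices and leaves
    the relevant entries, which are at least 1, unchanged.\<close>
  define v where "v i h = max 1 (u h ! i)" for i h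
  have v: "v i h = u h ! i" if "i < n" "h \<in> {1..H}" for i h
    using assms(6)[OF that(2)] that(1) unfolding v_def by (simp add: max_def)
  obtain F :: "nat \<Rightarrow> nat set" and X :: "nat set" where X: "finite X" "X \<noteq> {}"
    and F: "\<forall>i<n. finite (F i) \<and> F i \<noteq> {}"
      "\<forall>i<n. \<forall>h\<in>{1..H}. card (sumset h (F i)) = v i h * card (sumset h X)"
  proof -
    have "v i h > 0" for i h by (simp add: v_def)
    from proportional_sumset_cards[of v, OF this, of n H] show thesis
      by (elim exE conjE) (rule that)
  qed
  have finF: "finite (F i)" if "i < n" for i
    using F(1) that by blast
  have cardF: "card (sumset h (F i)) = v i h * card (sumset h X)" if "i < n" "h \<in> {1..H}" for i h
    using F(2) that by blast
  have "finite (\<Union>i<n. F i)" using finF by simp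
  then obtain m where "(\<Union>i<n. F i) \<subseteq> {..m}" using finite_nat_iff_bounded_le by metis
  then have Fm: "F i \<subseteq> {..m}" if "i < n" for i
    using that by blast
  \<comment> \<open>The compact \<open>K\<close> will contain every \<open>sumset h U\<close> with h
    \<le> H and so bound its measure.\<close>
  have "\<exists>W K. open W \<and> compact K \<and> (0 :: 'a) \<in> W \<and> W \<subseteq> K"
    using assms(1) by (simp add: locally_compact_space_def)
  then obtain W0 K where W0: "open W0" "compact K" "(0 :: 'a) \<in> W0" "W0 \<subseteq> K"
    by blast
  \<comment> \<open>Elements of \<open>sumset h (F i)\<close> are at most \<open>H * m\<close>, so
    up to sign all differences of distinct multiples of \<open>g\<close> that occur lie in
    \<open>T\<close>.\<close>
  define T where "T = nat_multiple g ` {1..H * m}"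
  have "closed T" by (intro finite_imp_closed) (simp add: T_def)
  then have "open (W0 - T)"
    using W0(1) by (rule open_Diff[rotated])
  moreover have "0 \<notin> T"
    using g unfolding T_def by (metis atLeastAtMost_iff imageE)
  ultimately have W0T: "open (W0 - T)" "0 \<in> W0 - T"
    using W0(3) by auto
  \<comment> \<open>Differences within \<open>W\<close> avoid \<open>T\<close>, so translates of
    \<open>W\<close> by distinct such multiples are disjoint.\<close>
  obtain W where W: "open W" "0 \<in> W" "\<And>x y. x \<in> W \<Longrightarrow> y \<in> W \<Longrightarrow> x - y \<in> W0 - T"
    using nhd_zero_diff[OF W0T] by metis
  obtain U where U: "open U" "0 \<in> U" "\<And>h. h \<le> H \<Longrightarrow> sumset h U \<subseteq> W"
    using nhd_zero_sumset[OF W(1,2), of H] by blast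
  have U_pos: "emeasure M (sumset h U) > 0" if "h \<in> {1..H}" for h
  proof (rule haar_measure_open_pos[OF assms(3) open_sumset[OF U(1)]])
    show "1 \<le> h" using that by simp
    show "sumset h U \<noteq> {}" using U(2) by (intro sumset_nonempty) blast
  qed
  have "W \<subseteq> K" using W(3)[OF _ W(2)] W0(4) by auto
  have U_fin: "emeasure M (sumset h U) < \<infinity>" if "h \<in> {1..H}" for h
  proof -
    have "sumset h U \<subseteq> K" using U(3)[of h] that \<open>W \<subseteq> K\<close> by auto
    moreover have "K \<in> sets M"
      using compact_imp_closed[OF W0(2)] by (simp add: haar(1))
    ultimately have "emeasure M (sumset h U) \<le> emeasure M K"
      by (rule emeasure_mono)
    also have "\<dots> < \<infinity>" by (rule haar(4)[OF W0(2)])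
    finally show ?thesis .
  qed
  have disj_aux: "nat_multiple g j + x \<noteq> nat_multiple g k + y"
    if "x \<in> W" "y \<in> W" "j < k" "k \<le> H * m" for j k x y
  proof
    assume "nat_multiple g j + x = nat_multiple g k + y"
    then have "x = nat_multiple g (k - j) + y"
      using \<open>j < k\<close> nat_multiple_add[of g j "k - j"] by (simp add: add.assoc)
    then have "x - y = nat_multiple g (k - j)"
      by simp
    moreover have "k - j \<in> {1..H * m}" using that(3,4) unfolding atLeastAtMost_iff by linarith
    ultimately show False using W(3)[OF that(1,2)] by (simp add: T_def)
  qed
  have disj: "(+) (nat_multiple g j) ` V \<inter> (+) (nat_multiple g k) ` V = {}"
    if "V \<subseteq> W" "j \<le> H * m" "k \<le> H * m" "j \<noteq> k" for j k V
  proof -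
    have "nat_multiple g j + x \<noteq> nat_multiple g k + y" if "x \<in> V" "y \<in> V" for x y
      using disj_aux[of x y j k] disj_aux[of y x k j] that \<open>V \<subseteq> W\<close> \<open>j \<le> H * m\<close> \<open>k \<le> H * m\<close> \<open>j \<noteq> k\<close>
      by (metis nat_neq_iff subsetD)
    then show ?thesis by blast
  qed
  \<comment> \<open>This is the case x = y = 0 of \<open>disj_aux\<close>, as 0 \<in> W.\<close>
  have inj: "inj_on (nat_multiple g) {..H * m}"
  proof (rule linorder_inj_onI')
    fix j k assume "j \<in> {..H * m}" "k \<in> {..H * m}" "j < k"
    then show "nat_multiple g j \<noteq> nat_multiple g k"
      using disj_aux[OF W(2) W(2), of j k] by simp
  qed

  define A where "A i = nat_multiple g ` F i + U" for i
  have sumset_A: "sumset h (A i) = nat_multiple g ` sumset h (F i) + sumset h U" for h i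
    unfolding A_def sumset_plus by (subst sumset_image) (simp_all add: nat_multiple_add)
  have open_A: "open (sumset h (A i))" if "h \<ge> 1" for h i
    unfolding A_def by (intro open_sumset open_set_plus U that)
  have meas: "emeasure M (sumset h (A i)) = of_nat (v i h * card (sumset h X)) * emeasure M (sumset h U)"
    if "i < n" "h \<in> {1..H}" for i h
  proof -
    have "sumset h (F i) \<subseteq> {..h * m}" using sumset_nat_le Fm that by blast
    moreover have "h * m \<le> H * m" using that by simp
    ultimately have sub: "sumset h (F i) \<subseteq> {..H * m}"
      by (meson atMost_subset_iff order_trans)
    have "emeasure M (sumset h (A i))
        = of_nat (card (nat_multiple g ` sumset h (F i))) * emeasure M (sumset h U)"
      unfolding sumset_A
    proof (rule haar_measure_separated_plus[OF assms(3)])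
      show "open (sumset h U)" using open_sumset U that by auto
      show "finite (nat_multiple g ` sumset h (F i))" using finF finite_sumset that by blast
      have "sumset h U \<subseteq> W" using U(3) that by simp
      then show "(+) x ` sumset h U \<inter> (+) y ` sumset h U = {}"
        if "x \<in> nat_multiple g ` sumset h (F i)" "y \<in> nat_multiple g ` sumset h (F i)" "x \<noteq> y" for x y
        using that sub disj[of "sumset h U"] by blast
    qed
    also have "card (nat_multiple g ` sumset h (F i)) = v i h * card (sumset h X)"
      using card_image[OF inj_on_subset[OF inj sub]] cardF[OF that] by simp
    finally show ?thesis .
  qed

  show ?thesis
  proof (intro exI[of _ "map A [0..<n]"] conjI ballI)
    \<comment> \<open>\<open>A i\<close> is its own 1-fold sumset, hence open.\<close>
    show "\<forall>i<n. map A [0..<n] ! i \<in> sets M"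
      using open_A[of 1] by (simp add: haar(1) sumset_1)
    fix h assume h: "h \<in> {1..H}"
    show "\<forall>i<n. sumset h (map A [0..<n] ! i) \<in> sets M"
      using open_A[of h] h by (simp add: haar(1))
    \<comment> \<open>The factor \<open>c\<close> does not depend on \<open>i\<close>. As it is
      positive and finite, scaling by \<open>c\<close> is strictly monotone, so the measures are
      ordered like the entries of \<open>u h\<close>.\<close>
    define c where "c = of_nat (card (sumset h X)) * emeasure M (sumset h U)"
    have c: "0 < c" "c < \<infinity>"
      using U_pos[OF h] U_fin[OF h] card_sumset_pos[OF X, of h]
      by (auto simp: c_def ennreal_zero_less_mult_iff ennreal_mult_less_top of_nat_less_top)
    have "strict_mono (\<lambda>k :: nat. of_nat k * c)"
      using c by (intro strict_monoI ennreal_mult_strict_right_mono) auto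
    moreover have "map (\<lambda>B. emeasure M (sumset h B)) (map A [0..<n]) = map (\<lambda>k. of_nat k * c) (u h)"
      using assms(6)[OF h] meas[OF _ h] v[OF _ h]
      by (intro nth_equalityI) (auto simp: c_def mult.assoc)
    ultimately show "normalization (map (\<lambda>B. emeasure M (sumset h B)) (map A [0..<n])) = normalization (u h)"
      by (simp only: normalization_map)
  qed simp
qed

end
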